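(* Let $n \ge 1$, let $w \in S_n$, let $p_w \in H^*_T(GL_n(\mathbb{C})/B)$ be the equivariant Schubert class of $w$, and let $s_i=(i,i+1)\in S_n$ be a simple transposition, $1 \le i \le n-1$. (1) If $ws_i > w$ then $p_w(v) = p_w(vs_i)$ for each $v \in S_n$. (2) If $s_iw > w$ then $s_i\bigl(p_w(v)\bigr) = p_w(s_iv)$ for each $v \in S_n$, where on the left-hand side $s_i$ acts on the polynomial $p_w(v)\in\mathbb{C}[t_1,\dots,t_n]$ by exchanging the variables $t_i$ and $t_{i+1}$.
   Context: $B \subset GL_n(\mathbb{C})$ is the subgroup of invertible upper-triangular matrices and $T$ the torus of invertible diagonal matrices. $S_n$ is the group of permutations of $\{1,\dots,n\}$, with product given by composition of functions, $(uv)(k)=u(v(k))$. The length $\ell(w)$ is the minimal number of simple transpositions in a factorization of $w$. Equivariant cohomology is described by GKM theory: $H^*_T(GL_n(\mathbb{C})/B)$ is the ring (under pointwise operations) of tuples $p=(p(v))_{v\in S_n}$ of polynomials $p(v)\in \mathbb{C}[t_1,\dots,t_n]$ such that $p(v)-p((jk)v)$ is divisible by $t_j-t_k$ for all $v\in S_n$ and all $1\le j<k\le n$. It is an algebra over $H^*_T(pt)=\mathbb{C}[t_1,\dots,t_n]$. The moment graph has vertex set $S_n$ and a directed edge $v\mapsto (jk)v$, labeled $t_j-t_k$ ($j<k$), whenever $\ell(v)>\ell((jk)v)$. Write $u \ge v$ if $u=v$ or there is a directed chain of edges $u\mapsto u_1\mapsto\cdots\mapsto v$ (Bruhat order), and $u>v$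 if moreover $u\neq v$. The equivariant Schubert class (canonical class) $p_w$, $w\in S_n$, is the unique element of $H^*_T(GL_n(\mathbb{C})/B)$ such that: $p_w(u)=0$ unless $u\ge w$; $p_w(w)=\prod (t_j-t_k)$, the product over all $j<k$ with $\ell((jk)w)<\ell(w)$; and every $p_w(u)$ is zero or homogeneous of polynomial degree $\ell(w)$. The classes $p_w$, $w\in S_n$, form a basis of $H^*_T(GL_n(\mathbb{C})/B)$ as a free $\mathbb{C}[t_1,\dots,t_n]$-module. *)

theory Defs
  imports Complex_Main "HOL-Library.Poly_Mapping" "HOL-Library.FuncSet"
    "HOL-Combinatorics.Permutations"
begin

section \<open>Polynomials\<close>

text \<open>
  A polynomial is a finitely supported map from exponent vectors to coefficients, with the
  (convolution) ring structure of \<^theory>\<open>HOL-Library.Poly_Mapping\<close>. The type allows all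
  variables \<open>t\<^sub>0, t\<^sub>1, t\<^sub>2, \<dots>\<close>; the ring in the variables \<open>t\<^sub>1, \<dots>, t\<^sub>n\<close> is the carrier set
  \<open>poly_ring n\<close>.
\<close>

type_synonym mpoly = "(nat \<Rightarrow>\<^sub>0 nat) \<Rightarrow>\<^sub>0 complex"

definition poly_ring :: "nat \<Rightarrow> mpoly set" where
  "poly_ring n = {f. \<forall>m \<in> Poly_Mapping.keys f. Poly_Mapping.keys m \<subseteq> {1..n}}"

definition tvar :: "nat \<Rightarrow> mpoly" where
  "tvar j = Poly_Mapping.single (Poly_Mapping.single j 1) 1"

definition monom_degree :: "(nat \<Rightarrow>\<^sub>0 nat) \<Rightarrow> nat" where
  "monom_degree m = (\<Sum>j \<in> Poly_Mapping.keys m. Poly_Mapping.lookup m j)"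

text \<open>The zero polynomial satisfies this predicate for every \<open>d\<close>.\<close>

definition zero_or_homogeneous :: "nat \<Rightarrow> mpoly \<Rightarrow> bool" where
  "zero_or_homogeneous d f \<longleftrightarrow> (\<forall>m \<in> Poly_Mapping.keys f. monom_degree m = d)"

text \<open>
  The inner \<open>map_key\<close> interchanges the \<open>i\<close>-th and \<open>k\<close>-th exponents of a monomial; the outer one
  relabels the monomials accordingly (relabelling by a map or by its inverse agree here,
  as the map is an involution).
\<close>

definition exchange_vars :: "nat \<Rightarrow> nat \<Rightarrow> mpoly \<Rightarrow> mpoly" where
  "exchange_vars i k f = Poly_Mapping.map_key (Poly_Mapping.map_key (transpose i k)) f"

lemma map_key_transpose_involutory:
  "Poly_Mapping.map_key (transpose i k) (Poly_Mapping.map_key (transpose i k) m) = m"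
  for m :: "nat \<Rightarrow>\<^sub>0 nat"
  by (simp add: map_key_compose map_key_id[unfolded id_def[symmetric]])

lemma inj_map_key_transpose:
  "inj (Poly_Mapping.map_key (transpose i k) :: (nat \<Rightarrow>\<^sub>0 nat) \<Rightarrow> _)"
  by (metis injI map_key_transpose_involutory)

lemma exchange_vars_single:
  "exchange_vars i k (Poly_Mapping.single m c) =
    Poly_Mapping.single (Poly_Mapping.map_key (transpose i k) m) c"
  using map_key_single[OF inj_map_key_transpose,
      of i k "Poly_Mapping.map_key (transpose i k) m" c]
  by (simp add: exchange_vars_def map_key_transpose_involutory)

lemma exchange_vars_tvar: "exchange_vars i k (tvar j) = tvar (transpose i k j)"
proof -
  have "Poly_Mapping.map_key (transpose i k) (Poly_Mapping.single j (1::nat))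
      = Poly_Mapping.single (transpose i k j) 1"
    using map_key_single[of "transpose i k" "transpose i k j" "1::nat"] by simp
  then show ?thesis
    by (simp add: tvar_def exchange_vars_single)
qed

lemma exchange_vars_const:
  "exchange_vars i k (Poly_Mapping.single 0 c) = Poly_Mapping.single 0 c"
  by (simp add: exchange_vars_single)

lemma exchange_vars_add: "exchange_vars i k (f + g) = exchange_vars i k f + exchange_vars i k g"
  unfolding exchange_vars_def by (rule map_key_plus[OF inj_map_key_transpose])

lemma mpoly_add_single_induct [case_names zero add_single]:
  assumes "P 0" and "\<And>f m c. P f \<Longrightarrow> P (f + Poly_Mapping.single m c)"
  shows "P (f :: mpoly)"
proof (induction f rule: update_induct)
  case (update f a b)
  have "Poly_Mapping.update a b f = f + Poly_Mapping.single a b"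
    using update(1)
    by (intro poly_mapping_eqI)
      (auto simp: lookup_update lookup_add lookup_single when_def in_keys_iff)
  with assms(2)[OF update(3)] show ?case by simp
qed (rule assms(1))

lemma exchange_vars_mult: "exchange_vars i k (f * g) = exchange_vars i k f * exchange_vars i k g"
proof -
  have base: "exchange_vars i k (Poly_Mapping.single m c * Poly_Mapping.single m' c')
      = exchange_vars i k (Poly_Mapping.single m c) * exchange_vars i k (Poly_Mapping.single m' c')"
    for m m' c c'
    by (simp add: exchange_vars_single mult_single map_key_plus)
  have zero: "exchange_vars i k 0 = 0"
    by (simp add: exchange_vars_def inj_map_key_transpose)
  have single: "exchange_vars i k (Poly_Mapping.single m c * g)
      = exchange_vars i k (Poly_Mapping.single m c) * exchange_vars i k g" for m c
    by (induction g rule: mpoly_add_single_induct)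
      (simp_all add: base zero exchange_vars_add distrib_left)
  show ?thesis
    by (induction f rule: mpoly_add_single_induct)
      (simp_all add: single zero exchange_vars_add distrib_right)
qed

section \<open>The symmetric group, length and Bruhat order\<close>

definition Sym :: "nat \<Rightarrow> (nat \<Rightarrow> nat) set" where
  "Sym n = {v. v permutes {1..n}}"

definition simple_transp :: "nat \<Rightarrow> nat \<Rightarrow> nat" where
  "simple_transp i = transpose i (i + 1)"

definition perm_length :: "nat \<Rightarrow> (nat \<Rightarrow> nat) \<Rightarrow> nat" where
  "perm_length n w = (LEAST l. \<exists>is. length is = l \<and> set is \<subseteq> {i. 1 \<le> i \<and> i < n} \<and>
     w = foldr (\<circ>) (map simple_transp is) id)"

definition moment_edge :: "nat \<Rightarrow> (nat \<Rightarrow> nat) \<Rightarrow> (nat \<Rightarrow> nat) \<Rightarrow> bool" where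
  "moment_edge n v v' \<longleftrightarrow> v \<in> Sym n \<and>
     (\<exists>j k. 1 \<le> j \<and> j < k \<and> k \<le> n \<and> v' = transpose j k \<circ> v \<and>
        perm_length n v > perm_length n (transpose j k \<circ> v))"

definition bruhat_ge :: "nat \<Rightarrow> (nat \<Rightarrow> nat) \<Rightarrow> (nat \<Rightarrow> nat) \<Rightarrow> bool" where
  "bruhat_ge n u v \<longleftrightarrow> (moment_edge n)\<^sup>*\<^sup>* u v"

definition bruhat_gt :: "nat \<Rightarrow> (nat \<Rightarrow> nat) \<Rightarrow> (nat \<Rightarrow> nat) \<Rightarrow> bool" where
  "bruhat_gt n u v \<longleftrightarrow> bruhat_ge n u v \<and> u \<noteq> v"

section \<open>Equivariant cohomology of the flag variety and Schubert classes\<close>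

text \<open>
  The GKM description. Tuples indexed by \<open>Sym n\<close> are extensional functions, so that equality of
  functions is equality of tuples. Quotients are required to lie in \<open>poly_ring n\<close>.
\<close>

definition HT_flag :: "nat \<Rightarrow> ((nat \<Rightarrow> nat) \<Rightarrow> mpoly) set" where
  "HT_flag n = {p \<in> Sym n \<rightarrow>\<^sub>E poly_ring n.
     \<forall>v \<in> Sym n. \<forall>j k. 1 \<le> j \<and> j < k \<and> k \<le> n \<longrightarrow>
       (\<exists>q \<in> poly_ring n. p v - p (transpose j k \<circ> v) = (tvar j - tvar k) * q)}"

text \<open>
  \<open>is_schubert_class n w p\<close>: \<open>p\<close> has the properties that characterize the class of \<open>w\<close> uniquely.
\<close>

definition is_schubert_class :: "nat \<Rightarrow> (nat \<Rightarrow> nat) \<Rightarrow> ((nat \<Rightarrow> nat) \<Rightarrow> mpoly) \<Rightarrow> bool" where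
  "is_schubert_class n w p \<longleftrightarrow> p \<in> HT_flag n \<and>
     (\<forall>u \<in> Sym n. \<not> bruhat_ge n u w \<longrightarrow> p u = 0) \<and>
     p w = (\<Prod>(j, k) \<in> {(j, k). 1 \<le> j \<and> j < k \<and> k \<le> n \<and>
              perm_length n (transpose j k \<circ> w) < perm_length n w}. tvar j - tvar k) \<and>
     (\<forall>u \<in> Sym n. zero_or_homogeneous (perm_length n w) (p u))"

end

theory Submission
  imports Defs
begin

text \<open>
  For (1) put \<open>M(v) = p(v) - p(v s\<^sub>i)\<close>, for (2) put \<open>M(v) = p(v) - s\<^sub>i(p(s\<^sub>i v))\<close>. In both cases \<open>M\<close>
  satisfies the divisibility conditions along all edges and is homogeneous of degree \<open>\<ell>(w)\<close>. Let \<open>u\<close>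
  be of minimal length with \<open>M(u) \<noteq> 0\<close>. Then \<open>M(u)\<close> is divisible by the labels of the \<open>\<ell>(u)\<close> edges
  leaving \<open>u\<close>, and also by the label of the edge between \<open>u\<close> and its partner \<open>u s\<^sub>i\<close> (resp. \<open>s\<^sub>i u\<close>),
  which enters \<open>u\<close> because \<open>M\<close> does not vanish at the partner either. These labels are pairwise
  coprime, so \<open>\<ell>(u) + 1 \<le> \<ell>(w)\<close>, whereas the support condition and \<open>w s\<^sub>i > w\<close> (resp. \<open>s\<^sub>i w > w\<close>)
  force \<open>\<ell>(u) \<ge> \<ell>(w)\<close>.
\<close>

section \<open>Length\<close>

lemma foldr_simple_transp: "foldr (\<circ>) (map simple_transp is) id = apply_adj_transps is"
  by (induction "is") (simp_all add: simple_transp_def)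

text \<open>Permutations are products of transpositions, and \<open>adj_transp_seq\<close> writes
  each transposition as a word in adjacent ones. Thus the \<open>LEAST\<close> in
  \<open>perm_length\<close> ranges over a nonempty set and is attained.\<close>

lemma Sym_word:
  assumes "w \<in> Sym n"
  shows "\<exists>is. set is \<subseteq> {i. 1 \<le> i \<and> i < n} \<and> apply_adj_transps is = w"
proof -
  have app: "apply_adj_transps (xs @ ys) = apply_adj_transps xs \<circ> apply_adj_transps ys" for xs ys
    by (induction xs) (simp_all add: o_assoc)
  have transp: "\<exists>is. set is \<subseteq> {i. 1 \<le> i \<and> i < n} \<and> apply_adj_transps is = transpose a b"
    if "1 \<le> a" "a < b" "b \<le> n" for a b
    using that set_adj_transp_seq[of a b] adj_transp_seq_correct[of a b]
    by (intro exI[of _ "adj_transp_seq a b"]) auto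
  have "w permutes {1..n}" using assms by (simp add: Sym_def)
  then show ?thesis
    using finite_atLeastAtMost
  proof (induction rule: permutes_induct)
    case id
    show ?case by (intro exI[of _ "[]"]) simp
  next
    case (swap a b q)
    obtain xs where "set xs \<subseteq> {i. 1 \<le> i \<and> i < n}" "apply_adj_transps xs = transpose a b"
      using transp[of a b] transp[of b a] swap(1-3)
      by (cases "a < b") (auto simp: transpose_commute)
    moreover obtain ys where "set ys \<subseteq> {i. 1 \<le> i \<and> i < n}" "apply_adj_transps ys = q"
      using swap by blast
    ultimately show ?case by (intro exI[of _ "xs @ ys"]) (auto simp: app)
  qed
qed

lemma perm_length_le:
  "set is \<subseteq> {i. 1 \<le> i \<and> i < n} \<Longrightarrow> perm_length n (apply_adj_transps is) \<le> length is"
  unfolding perm_length_def foldr_simple_transp by (rule Least_le) auto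

lemma reduced_word:
  assumes "w \<in> Sym n"
  obtains "is" where "set is \<subseteq> {i. 1 \<le> i \<and> i < n}" "w = apply_adj_transps is"
    "length is = perm_length n w"
proof -
  have "\<exists>l is. length is = l \<and> set is \<subseteq> {i. 1 \<le> i \<and> i < n} \<and> w = apply_adj_transps is"
    using Sym_word[OF assms] by auto
  from LeastI_ex[OF this] show ?thesis
    unfolding perm_length_def[of n w] foldr_simple_transp using that
    by (auto simp: perm_length_def foldr_simple_transp)
qed

lemma transpose_comp_Sym:
  "v \<in> Sym n \<Longrightarrow> 1 \<le> j \<Longrightarrow> j \<le> n \<Longrightarrow> 1 \<le> k \<Longrightarrow> k \<le> n \<Longrightarrow> transpose j k \<circ> v \<in> Sym n"
  unfolding Sym_def using permutes_compose[OF _ permutes_swap_id, of v "{1..n}" j k] by simp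

lemma simple_transp_comp_Sym:
  "v \<in> Sym n \<Longrightarrow> 1 \<le> i \<Longrightarrow> i < n \<Longrightarrow> simple_transp i \<circ> v \<in> Sym n"
  unfolding simple_transp_def by (rule transpose_comp_Sym) auto

lemma comp_simple_transp_Sym:
  "v \<in> Sym n \<Longrightarrow> 1 \<le> i \<Longrightarrow> i < n \<Longrightarrow> v \<circ> simple_transp i \<in> Sym n"
  unfolding Sym_def simple_transp_def
  using permutes_compose[OF permutes_swap_id, of i "{1..n}" "i + 1" v] by simp

lemma simple_transp_cancel [simp]:
  "simple_transp i \<circ> (simple_transp i \<circ> v) = v" "(v \<circ> simple_transp i) \<circ> simple_transp i = v"
  by (simp_all add: simple_transp_def fun_eq_iff)

lemma inj_simple_transp: "inj (simple_transp i)"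
  by (simp add: simple_transp_def)

lemma perm_length_simple_transp_comp:
  assumes "v \<in> Sym n" "1 \<le> i" "i < n"
  shows "perm_length n (simple_transp i \<circ> v) \<le> perm_length n v + 1"
proof -
  obtain "is" where "set is \<subseteq> {i. 1 \<le> i \<and> i < n}" "v = apply_adj_transps is"
    "length is = perm_length n v"
    using reduced_word[OF assms(1)] .
  then show ?thesis
    using perm_length_le[of "i # is" n] assms by (simp add: simple_transp_def)
qed

lemma perm_length_comp_simple_transp:
  assumes "v \<in> Sym n" "1 \<le> i" "i < n"
  shows "perm_length n (v \<circ> simple_transp i) \<le> perm_length n v + 1"
proof -
  obtain "is" where "set is \<subseteq> {i. 1 \<le> i \<and> i < n}" "v = apply_adj_transps is"
    "length is = perm_length n v"
    using reduced_word[OF assms(1)] .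
  then show ?thesis
    using perm_length_le[of "is @ [i]" n] assms by (simp add: simple_transp_def)
qed

section \<open>Reflections, left inversions and a lower bound for their number\<close>

definition reflections :: "nat \<Rightarrow> (nat \<Rightarrow> nat) set" where
  "reflections n = {transpose j k | j k. 1 \<le> j \<and> j < k \<and> k \<le> n}"

lemma transpose_in_reflections:
  "1 \<le> j \<Longrightarrow> j \<le> n \<Longrightarrow> 1 \<le> k \<Longrightarrow> k \<le> n \<Longrightarrow> j \<noteq> k \<Longrightarrow> transpose j k \<in> reflections n"
  unfolding reflections_def using transpose_commute[of j k]
  by (cases "j < k") (blast, metis (mono_tags, lifting) linorder_neqE_nat mem_Collect_eq)

lemma finite_reflections: "finite (reflections n)"
proof (rule finite_subset)
  show "reflections n \<subseteq> (\<lambda>(j, k). transpose j k) ` ({1..n} \<times> {1..n})"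
    by (force simp: reflections_def)
qed simp

lemma conj_simple_transp_transpose:
  "simple_transp i \<circ> transpose j k \<circ> simple_transp i
    = transpose (simple_transp i j) (simple_transp i k)"
  using transpose_comp_eq[of "simple_transp i" "simple_transp i j" "simple_transp i k"]
  by (simp add: simple_transp_def fun_eq_iff transpose_apply_commute[of "transpose i (Suc i)"])

lemma simple_transp_range:
  assumes "1 \<le> i" "i < n" "1 \<le> j" "j \<le> n"
  shows "1 \<le> simple_transp i j" "simple_transp i j \<le> n"
  using assms by (auto simp: simple_transp_def transpose_def)

lemma conj_simple_transp_reflections:
  assumes "1 \<le> i" "i < n" "\<tau> \<in> reflections n"
  shows "simple_transp i \<circ> \<tau> \<circ> simple_transp i \<in> reflections n"
proof -
  obtain j k where jk: "\<tau> = transpose j k" "1 \<le> j" "j < k" "k \<le> n"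
    using assms(3) by (auto simp: reflections_def)
  have "simple_transp i j \<noteq> simple_transp i k"
    using jk by (simp add: inj_eq[OF inj_simple_transp])
  with jk assms(1,2) show ?thesis
    unfolding jk(1) conj_simple_transp_transpose
    by (intro transpose_in_reflections simple_transp_range) auto
qed

text \<open>Collected as permutations rather than index pairs, so that conjugation by a simple
  transposition acts on them injectively.\<close>

definition left_inversions :: "nat \<Rightarrow> (nat \<Rightarrow> nat) \<Rightarrow> (nat \<Rightarrow> nat) set" where
  "left_inversions n u = {\<tau> \<in> reflections n. perm_length n (\<tau> \<circ> u) < perm_length n u}"

text \<open>If \<open>u = s v\<close> with \<open>v\<close> shorter, then \<open>s\<close> and the conjugates \<open>s \<tau> s\<close> of the left inversions
  \<open>\<tau>\<close> of \<open>v\<close> are left inversions of \<open>u\<close>.\<close>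

lemma perm_length_le_card_left_inversions:
  "u \<in> Sym n \<Longrightarrow> perm_length n u \<le> card (left_inversions n u)"
proof (induction "perm_length n u" arbitrary: u)
  case 0
  then show ?case by simp
next
  case (Suc l)
  obtain i "is" where ii: "set (i # is) \<subseteq> {i. 1 \<le> i \<and> i < n}" "u = apply_adj_transps (i # is)"
    "length (i # is) = perm_length n u"
  proof -
    obtain xs where xs: "set xs \<subseteq> {i. 1 \<le> i \<and> i < n}" "u = apply_adj_transps xs"
      "length xs = perm_length n u"
      using reduced_word[OF Suc.prems] .
    then have "xs \<noteq> []" using Suc.hyps(2) by auto
    then show ?thesis using that xs by (cases xs) auto
  qed
  let ?s = "simple_transp i"
  define v where "v = ?s \<circ> u"
  have i: "1 \<le> i" "i < n" using ii by auto
  have v: "v \<in> Sym n" unfolding v_def by (rule simple_transp_comp_Sym[OF Suc.prems i])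
  have u: "u = ?s \<circ> v" by (simp add: v_def)
  have "v = apply_adj_transps is"
    unfolding v_def ii(2) by (simp add: simple_transp_def fun_eq_iff)
  \<comment> \<open>Dropping the first letter of a reduced word bounds the length of
    \<open>v\<close> above by \<open>l\<close>; multiplying back by \<open>?s\<close> bounds it
    below.\<close>
  then have "perm_length n v \<le> l" using perm_length_le[of "is" n] ii Suc.hyps(2) by simp
  moreover have "perm_length n u \<le> perm_length n v + 1"
    unfolding u by (rule perm_length_simple_transp_comp[OF v i])
  ultimately have l: "perm_length n v = l" using Suc.hyps(2) by simp
  let ?c = "\<lambda>\<tau>. ?s \<circ> \<tau> \<circ> ?s"
  have fin: "finite (left_inversions n x)" for x
    using finite_reflections by (simp add: left_inversions_def)
  have inj: "inj ?c"
    by (rule inj_on_inverseI[of _ ?c]) (simp add: simple_transp_def fun_eq_iff)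
  \<comment> \<open>Conjugation by \<open>?s\<close> fixes \<open>?s\<close>, which is not a left
    inversion of \<open>v\<close> because \<open>?s \<circ> v = u\<close> is longer than
    \<open>v\<close>.\<close>
  have s: "?s \<notin> ?c ` left_inversions n v"
  proof -
    have "?c ?s = ?s" by (simp add: simple_transp_def fun_eq_iff)
    then have "?s \<in> ?c ` left_inversions n v \<longleftrightarrow> ?s \<in> left_inversions n v"
      using inj_image_mem_iff[OF inj, of ?s "left_inversions n v"] by simp
    then show ?thesis using l Suc.hyps(2) by (simp add: left_inversions_def flip: u)
  qed
  have "insert ?s (?c ` left_inversions n v) \<subseteq> left_inversions n u"
  proof (intro insert_subsetI image_subsetI)
    show "?s \<in> left_inversions n u"
      using i l Suc.hyps(2) transpose_in_reflections[of i n "i + 1", folded simple_transp_def]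
      by (simp add: left_inversions_def flip: v_def)
  next
    fix \<tau> assume \<tau>: "\<tau> \<in> left_inversions n v"
    then obtain j k where jk: "\<tau> = transpose j k" "1 \<le> j" "j < k" "k \<le> n"
      by (auto simp: left_inversions_def reflections_def)
    \<comment> \<open>Since \<open>\<tau> \<circ> v\<close> has length below \<open>l\<close>,
      multiplying by \<open>?s\<close> keeps the length at most \<open>l\<close>, hence below that
      of \<open>u\<close>.\<close>
    have "?c \<tau> \<circ> u = ?s \<circ> (\<tau> \<circ> v)" by (simp add: v_def comp_assoc)
    moreover have "\<tau> \<circ> v \<in> Sym n" using transpose_comp_Sym[OF v] jk by simp
    then have "perm_length n (?s \<circ> (\<tau> \<circ> v)) \<le> perm_length n (\<tau> \<circ> v) + 1"
      by (rule perm_length_simple_transp_comp[OF _ i])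
    ultimately show "?c \<tau> \<in> left_inversions n u"
      using \<tau> l Suc.hyps(2) conj_simple_transp_reflections[OF i]
      by (simp add: left_inversions_def)
  qed
  then have "card (insert ?s (?c ` left_inversions n v)) \<le> card (left_inversions n u)"
    by (rule card_mono[OF fin])
  moreover have "card (insert ?s (?c ` left_inversions n v)) = Suc (card (left_inversions n v))"
    using s fin inj by (simp add: card_image inj_on_subset)
  moreover have "l \<le> card (left_inversions n v)" using Suc.hyps(1)[of v] l v by simp
  ultimately show ?case using Suc.hyps(2) by simp
qed

text \<open>The index pairs of the labels on the edges of the moment graph leaving
  \<open>u\<close>.\<close>

definition lowering_pairs :: "nat \<Rightarrow> (nat \<Rightarrow> nat) \<Rightarrow> (nat \<times> nat) set" where
  "lowering_pairs n u = {(j, k). 1 \<le> j \<and> j < k \<and> k \<le> n \<and>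
     perm_length n (transpose j k \<circ> u) < perm_length n u}"

lemma finite_lowering_pairs: "finite (lowering_pairs n u)"
  by (rule finite_subset[of _ "{1..n} \<times> {1..n}"]) (auto simp: lowering_pairs_def)

lemma perm_length_le_card_lowering_pairs:
  assumes "u \<in> Sym n"
  shows "perm_length n u \<le> card (lowering_pairs n u)"
proof -
  have "left_inversions n u = (\<lambda>(j, k). transpose j k) ` lowering_pairs n u"
    by (force simp: left_inversions_def reflections_def lowering_pairs_def)
  then have "card (left_inversions n u) \<le> card (lowering_pairs n u)"
    using card_image_le[OF finite_lowering_pairs] by metis
  with perm_length_le_card_left_inversions[OF assms] show ?thesis by simp
qed

lemma bruhat_ge_cases: "bruhat_ge n u v \<Longrightarrow> u = v \<or> perm_length n v < perm_length n u"
  unfolding bruhat_ge_def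
  by (induction rule: rtranclp_induct) (auto simp: moment_edge_def)

section \<open>Divisibility by differences of variables\<close>

definition merge_exponent :: "nat \<Rightarrow> nat \<Rightarrow> (nat \<Rightarrow>\<^sub>0 nat) \<Rightarrow> (nat \<Rightarrow>\<^sub>0 nat)" where
  "merge_exponent j k m =
     Poly_Mapping.update j 0 m + Poly_Mapping.single k (Poly_Mapping.lookup m j)"

text \<open>The substitution of \<open>t_k\<close> for \<open>t_j\<close>, a ring endomorphism with
  kernel generated by \<open>t_j - t_k\<close>. Distinct monomials may merge, hence a sum of terms
  instead of a relabelling of keys.\<close>

definition identify_vars :: "nat \<Rightarrow> nat \<Rightarrow> mpoly \<Rightarrow> mpoly" where
  "identify_vars j k f = (\<Sum>m \<in> Poly_Mapping.keys f.
     Poly_Mapping.single (merge_exponent j k m) (Poly_Mapping.lookup f m))"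

lemma merge_exponent_add: "merge_exponent j k (m + m') = merge_exponent j k m + merge_exponent j k m'"
  by (rule poly_mapping_eqI)
    (simp add: merge_exponent_def lookup_add lookup_update lookup_single when_def)

lemma identify_vars_superset:
  assumes "finite K" "Poly_Mapping.keys f \<subseteq> K"
  shows "identify_vars j k f = (\<Sum>m \<in> K.
     Poly_Mapping.single (merge_exponent j k m) (Poly_Mapping.lookup f m))"
  unfolding identify_vars_def using assms
  by (intro sum.mono_neutral_left) (auto simp: in_keys_iff)

lemma identify_vars_zero [simp]: "identify_vars j k 0 = 0"
  by (simp add: identify_vars_def)

lemma identify_vars_single:
  "identify_vars j k (Poly_Mapping.single m c) = Poly_Mapping.single (merge_exponent j k m) c"
  by (simp add: identify_vars_def)

lemma identify_vars_add: "identify_vars j k (f + g) = identify_vars j k f + identify_vars j k g"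
proof -
  let ?K = "Poly_Mapping.keys f \<union> Poly_Mapping.keys g"
  have "finite ?K" by simp
  from identify_vars_superset[OF this, of f] identify_vars_superset[OF this, of g]
    identify_vars_superset[OF this, of "f + g"]
  show ?thesis by (simp add: keys_add lookup_add single_add sum.distrib)
qed

lemma identify_vars_diff: "identify_vars j k (f - g) = identify_vars j k f - identify_vars j k g"
  using identify_vars_add[of j k "f - g" g] by (simp add: algebra_simps)

lemma identify_vars_mult: "identify_vars j k (f * g) = identify_vars j k f * identify_vars j k g"
proof -
  have single: "identify_vars j k (Poly_Mapping.single m c * g)
      = identify_vars j k (Poly_Mapping.single m c) * identify_vars j k g" for m c
    by (induction g rule: mpoly_add_single_induct)
      (simp_all add: identify_vars_add identify_vars_single mult_single merge_exponent_add distrib_left)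
  show ?thesis
    by (induction f rule: mpoly_add_single_induct)
      (simp_all add: single identify_vars_add distrib_right)
qed

lemma identify_vars_tvar: "identify_vars j k (tvar i) = tvar (if i = j then k else i)"
proof -
  have "merge_exponent j k (Poly_Mapping.single i 1) = Poly_Mapping.single (if i = j then k else i) 1"
    by (rule poly_mapping_eqI)
      (auto simp: merge_exponent_def lookup_add lookup_update lookup_single when_def)
  then show ?thesis by (simp add: tvar_def identify_vars_single)
qed

lemma tvar_eq_iff [simp]: "tvar i = tvar j \<longleftrightarrow> i = j"
proof
  assume "tvar i = tvar j"
  then have "Poly_Mapping.keys (tvar i) = Poly_Mapping.keys (tvar j)" by simp
  then have "Poly_Mapping.single i (1::nat) = Poly_Mapping.single j 1" by (simp add: tvar_def)
  then have "Poly_Mapping.keys (Poly_Mapping.single i (1::nat)) = Poly_Mapping.keys (Poly_Mapping.single j (1::nat))"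
    by simp
  then show "i = j" by simp
qed simp

lemma tvar_power: "tvar j ^ a = Poly_Mapping.single (Poly_Mapping.single j a) 1"
  by (induction a) (simp_all add: tvar_def mult_single single_one flip: single_add)

text \<open>On a monomial \<open>m * t_j^a\<close>, with \<open>m\<close> free of
  \<open>t_j\<close>, the difference is \<open>m * (t_j^a - t_k^a)\<close>; additivity does the
  rest.\<close>

lemma tvar_diff_dvd_diff_identify_vars: "tvar j - tvar k dvd f - identify_vars j k f"
proof (induction f rule: mpoly_add_single_induct)
  case (add_single f m c)
  let ?m = "Poly_Mapping.update j 0 m" and ?a = "Poly_Mapping.lookup m j"
  have "?m + Poly_Mapping.single j ?a = m"
    by (rule poly_mapping_eqI) (simp add: lookup_add lookup_update lookup_single when_def)
  then have "Poly_Mapping.single m c = Poly_Mapping.single ?m c * tvar j ^ ?a"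
    by (simp add: tvar_power mult_single)
  moreover have "identify_vars j k (Poly_Mapping.single m c) = Poly_Mapping.single ?m c * tvar k ^ ?a"
    by (simp add: tvar_power mult_single identify_vars_single merge_exponent_def)
  ultimately have "Poly_Mapping.single m c - identify_vars j k (Poly_Mapping.single m c)
      = Poly_Mapping.single ?m c * (tvar j ^ ?a - tvar k ^ ?a)"
    by (simp add: algebra_simps)
  then have "tvar j - tvar k dvd
      Poly_Mapping.single m c - identify_vars j k (Poly_Mapping.single m c)"
    by (simp add: power_diff_sumr2)
  from dvd_add[OF add_single this] show ?case by (simp add: identify_vars_add algebra_simps)
qed simp

lemma tvar_diff_dvd_iff: "tvar j - tvar k dvd f \<longleftrightarrow> identify_vars j k f = 0"
proof
  show "identify_vars j k f = 0" if "tvar j - tvar k dvd f"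
    using that by (auto simp: identify_vars_mult identify_vars_diff identify_vars_tvar elim!: dvdE)
  show "tvar j - tvar k dvd f" if "identify_vars j k f = 0"
    using tvar_diff_dvd_diff_identify_vars[of j k f] that by simp
qed

lemma tvar_diff_dvd_swap: "tvar j - tvar k dvd f \<longleftrightarrow> tvar k - tvar j dvd f"
  using minus_dvd_iff[of "tvar j - tvar k" f] by simp

text \<open>Substituting \<open>t_k\<close> for \<open>t_j\<close> kills the product but not
  \<open>t_a - t_b\<close>, so it kills \<open>f\<close>, polynomials having no zero
  divisors.\<close>

lemma tvar_diff_dvd_mult_cancel:
  assumes "tvar j - tvar k dvd (tvar a - tvar b) * f" "a \<noteq> b" "{a, b} \<noteq> {j, k}"
  shows "tvar j - tvar k dvd f"
proof -
  have "identify_vars j k (tvar a - tvar b) \<noteq> 0"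
    using assms(2,3) by (auto simp: identify_vars_diff identify_vars_tvar)
  then show ?thesis using assms(1) by (simp add: tvar_diff_dvd_iff identify_vars_mult)
qed

text \<open>The labels are pairwise coprime: after one is split off, the others still divide the
  quotient. Ordering each pair prevents the same label from occurring twice up to sign.\<close>

lemma prod_tvar_diff_dvd:
  assumes "finite S" "\<And>j k. (j, k) \<in> S \<Longrightarrow> j < k" "\<And>j k. (j, k) \<in> S \<Longrightarrow> tvar j - tvar k dvd f"
  shows "(\<Prod>(j, k) \<in> S. tvar j - tvar k) dvd f"
  using assms
proof (induction S arbitrary: f rule: finite_induct)
  case (insert x S)
  obtain a b where x: "x = (a, b)" by (cases x)
  have "a < b" using insert.prems x by simp
  obtain g where g: "f = (tvar a - tvar b) * g"
    using insert.prems(2)[of a b] x by (auto elim: dvdE)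
  have "tvar j - tvar k dvd g" if "(j, k) \<in> S" for j k
  proof (rule tvar_diff_dvd_mult_cancel)
    show "tvar j - tvar k dvd (tvar a - tvar b) * g"
      using insert.prems(2)[of j k] that g by simp
    show "a \<noteq> b" using \<open>a < b\<close> by simp
    have "(a, b) \<noteq> (j, k)" using insert.hyps(2) x that by auto
    moreover have "j < k" using insert.prems(1) that by simp
    ultimately show "{a, b} \<noteq> {j, k}" using \<open>a < b\<close> by (auto simp: doubleton_eq_iff)
  qed
  then have "(\<Prod>(j, k) \<in> S. tvar j - tvar k) dvd g"
    using insert by simp
  then show ?case unfolding g using insert.hyps x by (simp add: mult_dvd_mono)
qed simp

section \<open>Degrees\<close>

lemma monom_degree_superset:
  assumes "finite K" "Poly_Mapping.keys m \<subseteq> K"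
  shows "monom_degree m = (\<Sum>j \<in> K. Poly_Mapping.lookup m j)"
  unfolding monom_degree_def using assms
  by (intro sum.mono_neutral_left) (auto simp: in_keys_iff)

lemma monom_degree_add: "monom_degree (m + m') = monom_degree m + monom_degree m'"
proof -
  let ?K = "Poly_Mapping.keys m \<union> Poly_Mapping.keys m'"
  have "finite ?K" by simp
  from monom_degree_superset[OF this, of m] monom_degree_superset[OF this, of m']
    monom_degree_superset[OF this, of "m + m'"]
  show ?thesis by (simp add: keys_add lookup_add sum.distrib)
qed

text \<open>Each linear factor contributes exactly 1 to the degree of a monomial, and the cofactor
  \<open>g\<close>, homogeneous or not, contributes at least 0.\<close>

lemma keys_prod_tvar_diff_mult_degree:
  assumes "finite S" "m \<in> Poly_Mapping.keys ((\<Prod>(j, k) \<in> S. tvar j - tvar k) * g)"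
  shows "card S \<le> monom_degree m"
  using assms
proof (induction S arbitrary: m rule: finite_induct)
  case (insert x S)
  obtain a b where x: "x = (a, b)" by (cases x)
  have "m \<in> Poly_Mapping.keys ((tvar a - tvar b) * ((\<Prod>(j, k) \<in> S. tvar j - tvar k) * g))"
    using insert x by (simp add: mult.assoc)
  then obtain m1 m2 where m: "m = m1 + m2" "m1 \<in> Poly_Mapping.keys (tvar a - tvar b)"
      "m2 \<in> Poly_Mapping.keys ((\<Prod>(j, k) \<in> S. tvar j - tvar k) * g)"
    using keys_mult by blast
  have "m1 \<in> Poly_Mapping.keys (tvar a) \<union> Poly_Mapping.keys (tvar b)"
    using m(2) by (auto simp: in_keys_iff lookup_minus)
  then have "monom_degree m1 = 1" by (auto simp: tvar_def monom_degree_def)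
  with insert.IH[OF m(3)] insert.hyps show ?case by (simp add: m(1) monom_degree_add)
qed simp

lemma zero_or_homogeneous_diff:
  "zero_or_homogeneous d f \<Longrightarrow> zero_or_homogeneous d g \<Longrightarrow> zero_or_homogeneous d (f - g)"
  by (force simp: zero_or_homogeneous_def in_keys_iff lookup_minus)

text \<open>The product of the labels divides \<open>f\<close>, so each monomial of \<open>f\<close>
  has degree at least \<open>card S\<close>; a nonzero \<open>f\<close> has a monomial.\<close>

lemma card_le_homogeneous_degree:
  assumes "finite S" "\<And>j k. (j, k) \<in> S \<Longrightarrow> j < k" "\<And>j k. (j, k) \<in> S \<Longrightarrow> tvar j - tvar k dvd f"
    and "zero_or_homogeneous d f" "f \<noteq> 0"
  shows "card S \<le> d"
proof -
  obtain g where g: "f = (\<Prod>(j, k) \<in> S. tvar j - tvar k) * g"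
    using prod_tvar_diff_dvd[OF assms(1-3)] by (auto elim: dvdE)
  obtain m where "m \<in> Poly_Mapping.keys f" using assms(5) by (metis keys_eq_empty ex_in_conv)
  with keys_prod_tvar_diff_mult_degree[OF assms(1), of m g] assms(4) show ?thesis
    by (auto simp: g zero_or_homogeneous_def)
qed

section \<open>Exchanging variables\<close>

lemma exchange_vars_zero [simp]: "exchange_vars i k 0 = 0"
  by (simp add: exchange_vars_def inj_map_key_transpose)

lemma exchange_vars_diff: "exchange_vars i k (f - g) = exchange_vars i k f - exchange_vars i k g"
  using exchange_vars_add[of i k "f - g" g] by (simp add: algebra_simps)

lemma exchange_vars_involutory [simp]: "exchange_vars i k (exchange_vars i k f) = f"
  by (induction f rule: mpoly_add_single_induct)
    (simp_all add: exchange_vars_add exchange_vars_single map_key_transpose_involutory)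

text \<open>Merging retains only the sum of the exponents at \<open>i\<close> and \<open>k\<close>,
  which the exchange preserves.\<close>

lemma identify_exchange_vars: "identify_vars i k (exchange_vars i k f) = identify_vars i k f"
proof (induction f rule: mpoly_add_single_induct)
  case (add_single f m c)
  have "merge_exponent i k (Poly_Mapping.map_key (transpose i k) m) = merge_exponent i k m"
    by (rule poly_mapping_eqI)
      (auto simp: merge_exponent_def lookup_add lookup_update lookup_single when_def map_key.rep_eq
        transpose_def)
  with add_single show ?case
    by (simp add: exchange_vars_add identify_vars_add exchange_vars_single identify_vars_single)
qed simp

lemma tvar_diff_dvd_diff_exchange_vars: "tvar i - tvar k dvd f - exchange_vars i k f"
  by (simp add: tvar_diff_dvd_iff identify_vars_diff identify_exchange_vars)

lemma exchange_vars_dvd: "f dvd g \<Longrightarrow> exchange_vars i k f dvd exchange_vars i k g"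
  by (auto simp: exchange_vars_mult elim!: dvdE)

lemma monom_degree_map_key_transpose:
  "monom_degree (Poly_Mapping.map_key (transpose i k) m) = monom_degree m"
proof -
  have "Poly_Mapping.keys (Poly_Mapping.map_key (transpose i k) m)
      = transpose i k ` Poly_Mapping.keys m"
    by (auto simp: in_keys_iff map_key.rep_eq in_transpose_image_iff)
  then show ?thesis
    by (simp add: monom_degree_def sum.reindex map_key.rep_eq)
qed

lemma zero_or_homogeneous_exchange_vars:
  assumes "zero_or_homogeneous d f"
  shows "zero_or_homogeneous d (exchange_vars i k f)"
  unfolding zero_or_homogeneous_def
proof
  fix m assume "m \<in> Poly_Mapping.keys (exchange_vars i k f)"
  then have "Poly_Mapping.map_key (transpose i k) m \<in> Poly_Mapping.keys f"
    by (simp add: exchange_vars_def in_keys_iff map_key.rep_eq inj_map_key_transpose)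
  with assms show "monom_degree m = d"
    by (metis zero_or_homogeneous_def monom_degree_map_key_transpose)
qed

section \<open>Vanishing\<close>

text \<open>The hypothesis \<open>extra\<close> provides, at a vertex of minimal length in the support, a factor that is
  not the label of a left inversion.\<close>

lemma class_vanishes:
  assumes gkm: "\<And>v j k. v \<in> Sym n \<Longrightarrow> 1 \<le> j \<Longrightarrow> j < k \<Longrightarrow> k \<le> n \<Longrightarrow>
      tvar j - tvar k dvd M v - M (transpose j k \<circ> v)"
    and homog: "\<And>v. v \<in> Sym n \<Longrightarrow> zero_or_homogeneous d (M v)"
    and extra: "\<And>v. v \<in> Sym n \<Longrightarrow> \<exists>j k. 1 \<le> j \<and> j < k \<and> k \<le> n \<and> tvar j - tvar k dvd M v \<and>
      (M (transpose j k \<circ> v) = 0 \<longrightarrow> M v = 0)"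
    and supp: "\<And>v. v \<in> Sym n \<Longrightarrow> M v \<noteq> 0 \<Longrightarrow> d \<le> perm_length n v"
    and "v \<in> Sym n"
  shows "M v = 0"
proof (rule ccontr)
  assume "M v \<noteq> 0"
  with \<open>v \<in> Sym n\<close> obtain u where u: "u \<in> Sym n" "M u \<noteq> 0"
    and min: "\<And>x. x \<in> Sym n \<Longrightarrow> perm_length n x < perm_length n u \<Longrightarrow> M x = 0"
    using ex_has_least_nat[of "\<lambda>x. x \<in> Sym n \<and> M x \<noteq> 0" v "perm_length n"]
    by (meson leD)
  obtain a b where ab: "1 \<le> a" "a < b" "b \<le> n" "tvar a - tvar b dvd M u"
      "M (transpose a b \<circ> u) \<noteq> 0"
    using extra[OF u(1)] u(2) by blast
  \<comment> \<open>Otherwise the partner of \<open>u\<close> would be shorter than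
    \<open>u\<close>, and \<open>M\<close> would vanish there by minimality.\<close>
  have notin: "(a, b) \<notin> lowering_pairs n u"
    using min[of "transpose a b \<circ> u"] ab transpose_comp_Sym[OF u(1), of a b]
    by (auto simp: lowering_pairs_def)
  let ?S = "insert (a, b) (lowering_pairs n u)"
  have "card ?S \<le> d"
  proof (rule card_le_homogeneous_degree)
    fix j k assume jk: "(j, k) \<in> ?S"
    show "j < k" using jk ab by (auto simp: lowering_pairs_def)
    show "tvar j - tvar k dvd M u"
    proof (cases "(j, k) = (a, b)")
      case False
      with jk have *: "1 \<le> j" "j < k" "k \<le> n"
          "perm_length n (transpose j k \<circ> u) < perm_length n u"
        by (auto simp: lowering_pairs_def)
      \<comment> \<open>With \<open>M\<close> zero at the lower end of the edge, \<open>gkm\<close>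
        says that the label divides \<open>M u\<close> itself.\<close>
      then have "M (transpose j k \<circ> u) = 0"
        by (intro min transpose_comp_Sym u) auto
      with gkm[OF u(1) *(1-3)] show ?thesis by simp
    qed (use ab in simp)
  qed (use finite_lowering_pairs homog u in auto)
  moreover have "perm_length n u + 1 \<le> card ?S"
    using perm_length_le_card_lowering_pairs[OF u(1)] notin finite_lowering_pairs by simp
  ultimately show False using supp[OF u] by simp
qed

section \<open>The two symmetries of Schubert classes\<close>

theorem proposition3p7:
  fixes n i :: nat and w :: "nat \<Rightarrow> nat" and p :: "(nat \<Rightarrow> nat) \<Rightarrow> mpoly"
  assumes "n \<ge> 1"
    and "w \<in> Sym n"
    and "is_schubert_class n w p"
    and "1 \<le> i" and "i \<le> n - 1"
  shows "(bruhat_gt n (w \<circ> simple_transp i) w \<longrightarrow>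
            (\<forall>v \<in> Sym n. p v = p (v \<circ> simple_transp i)))
       \<and> (bruhat_gt n (simple_transp i \<circ> w) w \<longrightarrow>
            (\<forall>v \<in> Sym n. exchange_vars i (i + 1) (p v) = p (simple_transp i \<circ> v)))"
proof -
  let ?s = "simple_transp i"
  have i: "1 \<le> i" "i < n" using assms by auto
  have gkm_less: "tvar j - tvar k dvd p v - p (transpose j k \<circ> v)"
    if "v \<in> Sym n" "1 \<le> j" "j < k" "k \<le> n" for v j k
  proof -
    have "p \<in> HT_flag n" using assms(3) by (simp add: is_schubert_class_def)
    then have "\<exists>q \<in> poly_ring n. p v - p (transpose j k \<circ> v) = (tvar j - tvar k) * q"
      unfolding HT_flag_def using that by simp
    then show ?thesis by auto
  qed
  \<comment> \<open>Both orders of the indices are allowed, because conjugation by \<open>?s\<close>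
    can reverse the order of a pair.\<close>
  have gkm: "tvar j - tvar k dvd p v - p (transpose j k \<circ> v)"
    if "v \<in> Sym n" "1 \<le> j" "j \<le> n" "1 \<le> k" "k \<le> n" "j \<noteq> k" for v j k
    using gkm_less[of v j k] gkm_less[of v k j] that
    by (cases "j < k") (auto simp: transpose_commute[of k j] tvar_diff_dvd_swap[of j k])
  have homog: "zero_or_homogeneous (perm_length n w) (p v)" if "v \<in> Sym n" for v
    using assms(3) that by (simp add: is_schubert_class_def)
  have supp: "v = w \<or> perm_length n w < perm_length n v" if "v \<in> Sym n" "p v \<noteq> 0" for v
    using assms(3) that bruhat_ge_cases by (auto simp: is_schubert_class_def)
  have right: "p v = p (v \<circ> ?s)" if gt: "bruhat_gt n (w \<circ> ?s) w" and "v \<in> Sym n" for v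
  proof -
    have lw: "perm_length n w < perm_length n (w \<circ> ?s)"
      using gt bruhat_ge_cases by (auto simp: bruhat_gt_def)
    have "p v - p (v \<circ> ?s) = 0"
    proof (rule class_vanishes[where M = "\<lambda>v. p v - p (v \<circ> ?s)" and d = "perm_length n w" and n = n])
      fix x assume x: "x \<in> Sym n"
      have xs: "x \<circ> ?s \<in> Sym n" by (rule comp_simple_transp_Sym[OF x i])
      show "zero_or_homogeneous (perm_length n w) (p x - p (x \<circ> ?s))"
        by (intro zero_or_homogeneous_diff homog x xs)
      \<comment> \<open>Swapping the positions \<open>i\<close> and \<open>i + 1\<close> is swapping
        the values found there, so \<open>x\<close> and \<open>x \<circ> ?s\<close> are joined by an
        edge; \<open>a\<close> and \<open>b\<close> below are these values in increasing
        order.\<close>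
      have refl: "transpose (x i) (x (i + 1)) \<circ> x = x \<circ> ?s"
      proof -
        have "bij x" using x by (simp add: Sym_def permutes_bij)
        then show ?thesis
          by (simp add: transpose_comp_eq simple_transp_def bij_is_inj inv_f_f)
      qed
      have rng: "1 \<le> x i" "x i \<le> n" "1 \<le> x (i + 1)" "x (i + 1) \<le> n" "x i \<noteq> x (i + 1)"
        using x i permutes_in_image[of x "{1..n}" i] permutes_in_image[of x "{1..n}" "i + 1"]
        by (auto simp: Sym_def inj_eq dest: permutes_inj)
      define a b where "a = min (x i) (x (i + 1))" and "b = max (x i) (x (i + 1))"
      have ab: "1 \<le> a" "a < b" "b \<le> n" "transpose a b \<circ> x = x \<circ> ?s"
        using rng refl by (auto simp: a_def b_def min_def max_def transpose_commute)
      \<comment> \<open>The difference changes sign on passing from \<open>x\<close> to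
        \<open>x \<circ> ?s\<close>, so it vanishes at both or at neither.\<close>
      show "\<exists>j k. 1 \<le> j \<and> j < k \<and> k \<le> n \<and> tvar j - tvar k dvd p x - p (x \<circ> ?s) \<and>
          (p (transpose j k \<circ> x) - p (transpose j k \<circ> x \<circ> ?s) = 0 \<longrightarrow> p x - p (x \<circ> ?s) = 0)"
        using ab gkm_less[OF x ab(1-3)] by (intro exI[of _ a] exI[of _ b]) auto
      show "perm_length n w \<le> perm_length n x" if "p x - p (x \<circ> ?s) \<noteq> 0"
      proof -
        have "p x \<noteq> 0 \<or> p (x \<circ> ?s) \<noteq> 0" using that by auto
        \<comment> \<open>If only \<open>x \<circ> ?s\<close> supports \<open>p\<close>, either it
          equals \<open>w\<close>, and then \<open>x = w \<circ> ?s\<close> is longer than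
          \<open>w\<close>, or it is longer than \<open>w\<close>, and then \<open>x\<close> is at
          most one shorter than it.\<close>
        moreover have "x \<circ> ?s = w \<Longrightarrow> x = w \<circ> ?s" by (metis simple_transp_cancel(2))
        ultimately show ?thesis
          using supp[OF x] supp[OF xs] lw perm_length_comp_simple_transp[OF x i] by fastforce
      qed
      fix j k :: nat assume jk: "1 \<le> j" "j < k" "k \<le> n"
      \<comment> \<open>Left and right multiplication commute, so this is the difference of the edge
        conditions at \<open>x\<close> and \<open>x \<circ> ?s\<close>, with the same label.\<close>
      show "tvar j - tvar k dvd
          p x - p (x \<circ> ?s) - (p (transpose j k \<circ> x) - p (transpose j k \<circ> x \<circ> ?s))"
        using dvd_diff[OF gkm_less[OF x jk] gkm_less[OF xs jk]]
        by (simp add: algebra_simps comp_assoc)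
    qed fact
    then show ?thesis by simp
  qed
  have left: "exchange_vars i (i + 1) (p v) = p (?s \<circ> v)"
    if gt: "bruhat_gt n (?s \<circ> w) w" and v: "v \<in> Sym n" for v
  proof -
    let ?e = "exchange_vars i (i + 1)"
    have lw: "perm_length n w < perm_length n (?s \<circ> w)"
      using gt bruhat_ge_cases by (auto simp: bruhat_gt_def)
    have "p v - ?e (p (?s \<circ> v)) = 0"
    proof (rule class_vanishes[where M = "\<lambda>v. p v - ?e (p (?s \<circ> v))" and d = "perm_length n w" and n = n])
      fix x assume x: "x \<in> Sym n"
      have sx: "?s \<circ> x \<in> Sym n" by (rule simple_transp_comp_Sym[OF x i])
      show "zero_or_homogeneous (perm_length n w) (p x - ?e (p (?s \<circ> x)))"
        by (intro zero_or_homogeneous_diff zero_or_homogeneous_exchange_vars homog x sx)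
      have "tvar i - tvar (i + 1) dvd p x - p (?s \<circ> x)"
        using gkm_less[OF x i(1), of "i + 1"] i by (simp add: simple_transp_def)
      \<comment> \<open>The term \<open>p (?s \<circ> x)\<close> is inserted in between: one
        difference is an edge condition, the other compares a polynomial with its own
        exchange.\<close>
      from dvd_add[OF this tvar_diff_dvd_diff_exchange_vars[of i "i + 1" "p (?s \<circ> x)"]]
      have "tvar i - tvar (i + 1) dvd p x - ?e (p (?s \<circ> x))" by simp
      \<comment> \<open>The value at \<open>?s \<circ> x\<close> is minus the image under
        \<open>?e\<close> of the value at \<open>x\<close>.\<close>
      moreover have "p x - ?e (p (?s \<circ> x)) = 0" if "p (?s \<circ> x) - ?e (p (?s \<circ> (?s \<circ> x))) = 0"
        using that by simp
      ultimately show "\<exists>j k. 1 \<le> j \<and> j < k \<and> k \<le> n \<and> tvar j - tvar k dvd p x - ?e (p (?s \<circ> x)) \<and>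
          (p (transpose j k \<circ> x) - ?e (p (?s \<circ> (transpose j k \<circ> x))) = 0
            \<longrightarrow> p x - ?e (p (?s \<circ> x)) = 0)"
        using i by (intro exI[of _ i] exI[of _ "i + 1"]) (simp add: simple_transp_def)
      show "perm_length n w \<le> perm_length n x" if "p x - ?e (p (?s \<circ> x)) \<noteq> 0"
      proof -
        have "p x \<noteq> 0 \<or> p (?s \<circ> x) \<noteq> 0" using that by auto
        moreover have "?s \<circ> x = w \<Longrightarrow> x = ?s \<circ> w" by (metis simple_transp_cancel(1))
        ultimately show ?thesis
          using supp[OF x] supp[OF sx] lw perm_length_simple_transp_comp[OF x i] by fastforce
      qed
      fix j k :: nat assume jk: "1 \<le> j" "j < k" "k \<le> n"
      let ?j = "?s j" and ?k = "?s k"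
      have conj: "transpose ?j ?k \<circ> (?s \<circ> x) = ?s \<circ> (transpose j k \<circ> x)"
        unfolding conj_simple_transp_transpose[symmetric]
        by (simp add: comp_assoc)
      \<comment> \<open>Left multiplication by \<open>?s\<close> carries the edge at
        \<open>x\<close> to one whose label has its indices moved by \<open>?s\<close>; applying
        \<open>?e\<close> moves them back to \<open>j\<close> and \<open>k\<close>.\<close>
      have "tvar ?j - tvar ?k dvd p (?s \<circ> x) - p (?s \<circ> (transpose j k \<circ> x))"
        using gkm[OF sx, of ?j ?k] simple_transp_range[OF i, of j] simple_transp_range[OF i, of k] jk
        unfolding conj by (simp add: inj_eq[OF inj_simple_transp])
      from exchange_vars_dvd[OF this, of i "i + 1"]
      have "tvar j - tvar k dvd ?e (p (?s \<circ> x)) - ?e (p (?s \<circ> (transpose j k \<circ> x)))"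
        by (simp add: exchange_vars_diff exchange_vars_tvar simple_transp_def)
      from dvd_diff[OF gkm_less[OF x jk] this]
      show "tvar j - tvar k dvd p x - ?e (p (?s \<circ> x)) -
          (p (transpose j k \<circ> x) - ?e (p (?s \<circ> (transpose j k \<circ> x))))"
        by (simp add: algebra_simps)
    qed fact
    then have "?e (p v) = ?e (?e (p (?s \<circ> v)))" by simp
    then show ?thesis by simp
  qed
  from right left show ?thesis by blast
qed

end
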